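(* Suppose that the following conditions hold. (C1) $W(0)=0$, $W(t)$ is decreasing on $(-\infty,0)$ and increasing on $(0,\infty)$. (C2) $W'(t)$ is non-decreasing, almost everywhere. (A1) For any fixed $\lambda\ge 0$ and $t$, the equation $\int_{-\infty}^{\infty}W'(s-c)\,f(s\mid t-\lambda)\,ds=0$ has the unique solution $c\equiv\psi_\lambda(t)$, such that $f(\psi_\lambda(t)\mid t-\lambda)>0$. Let $\delta_\psi(\mathbf{X})=X_1-\psi(D)$ be a location equivariant estimator of $\theta_1$, where $\psi:\mathbb{R}\to\mathbb{R}$. Let $\underline{\psi}(t)$ and $\overline{\psi}(t)$ be functions such that $\underline{\psi}(t)<\psi_\lambda(t)<\overline{\psi}(t)$ for all $\lambda\ge 0$ and any $t$. For any fixed $t$, define $$\psi^*(t)=(\underline{\psi}(t)\vee\psi(t))\wedge\overline{\psi}(t)=\underline{\psi}(t)\vee(\psi(t)\wedge\overline{\psi}(t)).$$ Then $$R_1(\boldsymbol{\theta},\delta_\psi)\ \ge\ R_1(\boldsymbol{\theta},\delta_{\psi^*})\qquad\text{for any }\boldsymbol{\theta}\in\Theta_0,$$ where $\delta_{\psi^*}(\mathbf{X})=X_1-\psi^*(D)$.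
   Context: Model: $\mathbf{X}=(X_1,X_2)$ has joint probability density function $f(x_1-\theta_1,x_2-\theta_2)$, $(x_1,x_2)\in\mathbb{R}^2$, where $f$ is a specified probability density on $\mathbb{R}^2$ and $\boldsymbol{\theta}=(\theta_1,\theta_2)\in\Theta_0=\{(t_1,t_2)\in\mathbb{R}^2: t_1\le t_2\}$ is unknown. Put $D=X_2-X_1$ and $\lambda=\theta_2-\theta_1\in[0,\infty)$. The loss in estimating $\theta_1$ by $a\in\mathbb{R}$ is $W(a-\theta_1)$, where $W:\mathbb{R}\to[0,\infty)$ is a specified function, and the risk of an estimator $\delta$ is $R_1(\boldsymbol{\theta},\delta)=E_{\boldsymbol{\theta}}[W(\delta(\mathbf{X})-\theta_1)]$. A location equivariant estimator of $\theta_1$ is one of the form $\delta_\psi(\mathbf{X})=X_1-\psi(D)$ with $\psi:\mathbb{R}\to\mathbb{R}$. $x\vee y$ and $x\wedge y$ denote the maximum and the minimum of $x$ and $y$. Conditional density: $f(s\mid t)=\dfrac{f(s,s+t)}{\int_{-\infty}^{\infty}f(u,u+t)\,du}$ (the conditional density of $X_1-\theta_1$ given $D=t$ is $f(s\mid t-\lambda)$).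
   Formalization: W is additionally assumed absolutely continuous on compact intervals; otherwise the claim fails, e.g. W(t)=|t|+J·1_{t>1} with large J and X1 standard normal independent of D. ψ is taken Borel measurable so that the risk is defined. *)

theory Defs
  imports "HOL-Analysis.Analysis"
begin

definition prob_density :: "(real \<times> real \<Rightarrow> real) \<Rightarrow> bool" where
  "prob_density f \<longleftrightarrow>
     f \<in> borel_measurable borel \<and> (\<forall>x. 0 \<le> f x) \<and> (\<integral>\<^sup>+x. ennreal (f x) \<partial>lborel) = 1"

definition Theta0 :: "(real \<times> real) set" where
  "Theta0 = {\<theta>. fst \<theta> \<le> snd \<theta>}"

text \<open>The law of \<open>X = (X1, X2)\<close> under \<open>\<theta>\<close>; the model is realised canonically, with
  \<open>X\<close> the identity on the plane.\<close>

definition law :: "(real \<times> real \<Rightarrow> real) \<Rightarrow> real \<times> real \<Rightarrow> (real \<times> real) measure" where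
  "law f \<theta> = density lborel (\<lambda>(x1, x2). ennreal (f (x1 - fst \<theta>, x2 - snd \<theta>)))"

text \<open>The loss is nonnegative and its expectation may be infinite, so the risk is a
  nonnegative extended real; the Bochner integral would return 0 in the infinite case.\<close>

definition risk1 ::
  "(real \<times> real \<Rightarrow> real) \<Rightarrow> (real \<Rightarrow> real) \<Rightarrow> real \<times> real \<Rightarrow> (real \<times> real \<Rightarrow> real) \<Rightarrow> ennreal" where
  "risk1 f W \<theta> \<delta> = (\<integral>\<^sup>+x. ennreal (W (\<delta> x - fst \<theta>)) \<partial>law f \<theta>)"

definition equivariant_est :: "(real \<Rightarrow> real) \<Rightarrow> real \<times> real \<Rightarrow> real" where
  "equivariant_est \<psi> = (\<lambda>(x1, x2). x1 - \<psi> (x2 - x1))"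

text \<open>\<open>cond_density f s t\<close> is \<open>f(s | t)\<close>.\<close>

definition cond_density :: "(real \<times> real \<Rightarrow> real) \<Rightarrow> real \<Rightarrow> real \<Rightarrow> real" where
  "cond_density f s t = f (s, s + t) / (LINT u|lborel. f (u, u + t))"

text \<open>Absolute continuity on every compact interval. Without it a function is not determined
  by its almost everywhere derivative (jump functions, the Cantor function), and conditions
  on the derivative of the loss alone say nothing about the risk.\<close>

definition locally_abs_cont :: "(real \<Rightarrow> real) \<Rightarrow> bool" where
  "locally_abs_cont W \<longleftrightarrow>
     (\<forall>c d. \<forall>\<epsilon>>0. \<exists>\<delta>>0. \<forall>n (a :: nat \<Rightarrow> real) b.
        (\<forall>i<n. c \<le> a i \<and> a i \<le> b i \<and> b i \<le> d) \<and>
        disjoint_family_on (\<lambda>i. {a i<..<b i}) {..<n} \<and>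
        (\<Sum>i<n. b i - a i) < \<delta> \<longrightarrow>
        (\<Sum>i<n. \<bar>W (b i) - W (a i)\<bar>) < \<epsilon>)"

definition cond_C1 :: "(real \<Rightarrow> real) \<Rightarrow> bool" where
  "cond_C1 W \<longleftrightarrow> W 0 = 0 \<and> antimono_on {..<0} W \<and> mono_on {0<..} W"

definition cond_C2 :: "(real \<Rightarrow> real) \<Rightarrow> bool" where
  "cond_C2 W \<longleftrightarrow>
     (\<exists>N \<in> null_sets lborel.
        (\<forall>t. t \<notin> N \<longrightarrow> W differentiable (at t)) \<and> mono_on (- N) (deriv W))"

text \<open>\<open>pl lam t\<close> is \<open>\<psi>\<^sub>\<lambda>(t)\<close>. A solution of the equation is required to make the integrand
  integrable; the plain Bochner integral also vanishes when the integrand is not integrable.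
  The value of \<^term>\<open>deriv W\<close> on the null set where it is unspecified does not affect the
  integral.\<close>

definition cond_A1 ::
  "(real \<times> real \<Rightarrow> real) \<Rightarrow> (real \<Rightarrow> real) \<Rightarrow> (real \<Rightarrow> real \<Rightarrow> real) \<Rightarrow> bool" where
  "cond_A1 f W pl \<longleftrightarrow>
     (\<forall>lam\<ge>0. \<forall>t.
        (\<forall>c. has_bochner_integral lborel (\<lambda>s. deriv W (s - c) * cond_density f s (t - lam)) 0
             \<longleftrightarrow> c = pl lam t) \<and>
        cond_density f (pl lam t) (t - lam) > 0)"

definition psi_star ::
  "(real \<Rightarrow> real) \<Rightarrow> (real \<Rightarrow> real) \<Rightarrow> (real \<Rightarrow> real) \<Rightarrow> real \<Rightarrow> real" where
  "psi_star lo hi \<psi> t = min (max (lo t) (\<psi> t)) (hi t)"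

lemma psi_star_alt:
  "lo t < hi t \<Longrightarrow> psi_star lo hi \<psi> t = max (lo t) (min (\<psi> t) (hi t))"
  by (auto simp: psi_star_def min_def max_def)

end

theory Submission
  imports Defs
begin

text \<open>Off a null set, the monotone derivative of the absolutely continuous loss bounds its
  increments from the correct side, as for a convex function. If \<open>c'\<close> lies between \<open>c\<close> and
  \<open>c\<^sub>0 = \<psi>\<^sub>\<lambda>(t)\<close>, this gives
  \<open>W (s - c) \<ge> W (s - c') + (c' - c) * W' (s - c\<^sub>0)\<close> for almost every \<open>s\<close>; the last term has
  conditional mean zero, so moving \<open>c\<close> towards \<open>\<psi>\<^sub>\<lambda>(t)\<close> never increases the conditional risk.
  Integrating over \<open>t\<close> finishes the proof. The bounds, and hence \<open>\<psi>\<^sup>*\<close>, may fail to be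
  measurable, so the risk of the truncated estimator is a lower integral; it is handled through
  the measurable functions below the integrand.\<close>

section \<open>Absolute continuity: from almost everywhere bounds on the derivative to bounds on
  increments\<close>

lemma locally_abs_cont_uminus:
  "locally_abs_cont W \<Longrightarrow> locally_abs_cont (\<lambda>x. - W x)"
  by (simp add: locally_abs_cont_def abs_minus_commute)

text \<open>The case \<open>n = 1\<close> of the definition suffices. Continuity later makes the
  loss Borel measurable.\<close>

lemma locally_abs_cont_imp_continuous:
  assumes "locally_abs_cont W"
  shows "continuous_on UNIV W"
proof (clarsimp simp: continuous_on_iff)
  fix x e :: real
  assume "0 < e"
  then obtain d where "0 < d" and d: "\<And>n (a :: nat \<Rightarrow> real) b.
      (\<forall>i<n. x - 1 \<le> a i \<and> a i \<le> b i \<and> b i \<le> x + 1) \<Longrightarrow>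
      disjoint_family_on (\<lambda>i. {a i<..<b i}) {..<n} \<Longrightarrow>
      (\<Sum>i<n. b i - a i) < d \<Longrightarrow> (\<Sum>i<n. \<bar>W (b i) - W (a i)\<bar>) < e"
    using assms unfolding locally_abs_cont_def by meson
  have "dist (W y) (W x) < e" if "dist y x < min d 1" for y
    using d[of 1 "\<lambda>_. min x y" "\<lambda>_. max x y"] that
    by (auto simp: disjoint_family_on_def dist_real_def min_def max_def abs_if split: if_splits)
  then show "\<exists>d>0. \<forall>x'. dist x' x < d \<longrightarrow> dist (W x') (W x) < e"
    using \<open>0 < d\<close> by (intro exI[of _ "min d 1"]) auto
qed

text \<open>The straddle lemma of Henstock-Kurzweil integration. Because \<open>x\<close> lies
  between \<open>u\<close> and \<open>v\<close>, the linearisation errors \<open>e * (x - u)\<close>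
  and \<open>e * (v - x)\<close> add up to exactly \<open>e * (v - u)\<close>.\<close>

lemma deriv_straddle:
  fixes F :: "real \<Rightarrow> real"
  assumes "(F has_real_derivative D) (at x)" "0 < e"
  obtains d where "0 < d"
    "\<And>u v. u \<le> x \<Longrightarrow> x \<le> v \<Longrightarrow> u \<in> ball x d \<Longrightarrow> v \<in> ball x d \<Longrightarrow> (D - e) * (v - u) \<le> F v - F u"
proof -
  obtain d where d: "0 < d" "\<And>y. norm (y - x) < d \<Longrightarrow> norm (F y - F x - D * (y - x)) \<le> e * norm (y - x)"
    using assms unfolding has_field_derivative_def has_derivative_at_alt by blast
  have "(D - e) * (v - u) \<le> F v - F u" if "u \<le> x" "x \<le> v" "u \<in> ball x d" "v \<in> ball x d" for u v
  proof -
    have "\<bar>F u - F x - D * (u - x)\<bar> \<le> e * (x - u)" "\<bar>F v - F x - D * (v - x)\<bar> \<le> e * (v - x)"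
      using d(2)[of u] d(2)[of v] that by (auto simp: dist_real_def)
    then show ?thesis by (auto simp: algebra_simps abs_le_iff)
  qed
  with d(1) show ?thesis using that by blast
qed

text \<open>Disjointness turns the total length into the measure of the union, which
  \<open>U\<close> dominates. This supplies the smallness hypothesis in the definition of absolute
  continuity.\<close>

lemma sum_length_le_measure:
  fixes a b :: "nat \<Rightarrow> real"
  assumes "disjoint_family_on (\<lambda>i. {a i<..<b i}) {..<n}" "\<And>i. i < n \<Longrightarrow> a i \<le> b i"
    and "\<And>i. i < n \<Longrightarrow> {a i<..<b i} \<subseteq> U" "open U" "emeasure lborel U < ennreal e"
  shows "(\<Sum>i<n. b i - a i) < e"
proof -
  have "ennreal (\<Sum>i<n. b i - a i) = (\<Sum>i<n. ennreal (b i - a i))"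
    using assms(2) by (intro sum_ennreal[symmetric]) auto
  also have "\<dots> = (\<Sum>i<n. emeasure lborel {a i<..<b i})"
    using assms(2) by (intro sum.cong) auto
  also have "\<dots> = emeasure lborel (\<Union>i<n. {a i<..<b i})"
    using assms(1) by (intro sum_emeasure) auto
  also have "\<dots> \<le> emeasure lborel U"
    using assms(3,4) by (intro emeasure_mono) auto
  also have "\<dots> < ennreal e" by fact
  finally show ?thesis
    using assms(2) by (subst (asm) ennreal_less_iff) (auto intro!: sum_nonneg)
qed

text \<open>A gauge argument in place of integrating the derivative. In a fine tagged division,
  intervals tagged outside \<open>N\<close> satisfy the straddle bound with slope
  \<open>m - e\<close>; those tagged in \<open>N\<close> have small total length, so absolute
  continuity makes their increments small. The term \<open>(\<bar>m - e\<bar> + 1) * e\<close> pays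
  for the second kind: \<open>e\<close> for their increments and
  \<open>\<bar>m - e\<bar> * e\<close> for the length they take away from the first kind.\<close>

lemma locally_abs_cont_growth_approx:
  fixes a b m e :: real
  assumes ac: "locally_abs_cont W" and N: "N \<in> null_sets lborel"
    and D: "\<And>x. x \<in> {a..b} - N \<Longrightarrow> (W has_real_derivative D x) (at x)"
    and m: "\<And>x. x \<in> {a..b} - N \<Longrightarrow> m \<le> D x"
    and "a \<le> b" "0 < e"
  shows "(m - e) * (b - a) - (\<bar>m - e\<bar> + 1) * e \<le> W b - W a"
proof -
  obtain d0 where "0 < d0" and d0: "\<And>n (u :: nat \<Rightarrow> real) v.
      (\<forall>i<n. a \<le> u i \<and> u i \<le> v i \<and> v i \<le> b) \<Longrightarrow>
      disjoint_family_on (\<lambda>i. {u i<..<v i}) {..<n} \<Longrightarrow>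
      (\<Sum>i<n. v i - u i) < d0 \<Longrightarrow> (\<Sum>i<n. \<bar>W (v i) - W (u i)\<bar>) < e"
    using ac \<open>0 < e\<close> unfolding locally_abs_cont_def by meson
  \<comment> \<open>Over the intervals tagged in \<open>N\<close>, \<open>d0\<close> controls the
    increments of \<open>W\<close> and \<open>e\<close> the total length itself.\<close>
  define d where "d = min d0 e"
  have "0 < d" using \<open>0 < d0\<close> \<open>0 < e\<close> by (simp add: d_def)
  obtain U where U: "open U" "N \<subseteq> U" "emeasure lborel (U - N) < d"
    using outer_regular_lborel[of N d] N \<open>0 < d\<close> by (metis null_setsD2 sets_lborel)
  then have "emeasure lborel U < d"
    using emeasure_Diff_null_set[OF N, of U] by simp
  \<comment> \<open>The radius depends on the tag: at points of \<open>N\<close> the ball stays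
    inside the open cover, at other points of the interval it is small enough for the straddle
    bound. Elsewhere any radius will do.\<close>
  have "\<exists>r>0. (x \<in> N \<longrightarrow> ball x r \<subseteq> U) \<and> (x \<in> {a..b} - N \<longrightarrow>
      (\<forall>u v. u \<le> x \<longrightarrow> x \<le> v \<longrightarrow> u \<in> ball x r \<longrightarrow> v \<in> ball x r \<longrightarrow>
         (m - e) * (v - u) \<le> W v - W u))" for x
  proof (cases "x \<in> N")
    case True
    then show ?thesis using U by (metis DiffE openE subsetD)
  next
    case False
    show ?thesis
    proof (cases "x \<in> {a..b}")
      case True
      obtain r where "0 < r" and r: "\<And>u v. u \<le> x \<Longrightarrow> x \<le> v \<Longrightarrow> u \<in> ball x r \<Longrightarrow> v \<in> ball x r \<Longrightarrow>
          (D x - e) * (v - u) \<le> W v - W u"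
        using deriv_straddle[OF D \<open>0 < e\<close>] True False by (metis DiffI)
      have "(m - e) * (v - u) \<le> (D x - e) * (v - u)" if "u \<le> x" "x \<le> v" for u v
        using m[of x] True False that by (intro mult_right_mono) auto
      with r \<open>0 < r\<close> False show ?thesis by (meson order_trans)
    qed (use False in \<open>auto intro: exI[of _ 1]\<close>)
  qed
  then obtain r where r: "\<And>x. 0 < r x" "\<And>x. x \<in> N \<Longrightarrow> ball x (r x) \<subseteq> U"
    "\<And>x u v. x \<in> {a..b} - N \<Longrightarrow> u \<le> x \<Longrightarrow> x \<le> v \<Longrightarrow> u \<in> ball x (r x) \<Longrightarrow> v \<in> ball x (r x) \<Longrightarrow>
         (m - e) * (v - u) \<le> W v - W u"
    by metis
  have "gauge (\<lambda>x. ball x (r x))"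
    using r(1) by (simp add: gauge_def)
  then obtain p where p: "p tagged_division_of {a..b}" "(\<lambda>x. ball x (r x)) fine p"
    by (rule fine_division_exists_real)
  have fin: "finite p" using p(1) by blast
  have elt: "\<exists>u v. K = {u..v} \<and> u \<le> x \<and> x \<le> v \<and> a \<le> u \<and> v \<le> b \<and> {u..v} \<subseteq> ball x (r x)"
    if xK: "(x, K) \<in> p" for x K
  proof -
    obtain u v where K: "K = {u..v}" using tagged_division_ofD(4)[OF p(1) xK] by auto
    moreover have "x \<in> K" "K \<subseteq> {a..b}" "K \<subseteq> ball x (r x)"
      using tagged_division_ofD(2,3)[OF p(1) xK] fineD[OF p(2) xK] by auto
    ultimately show ?thesis by fastforce
  qed
  define q where "q = {z \<in> p. fst z \<in> N}"
  have "q \<subseteq> p" "finite q" using fin by (auto simp: q_def)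
  \<comment> \<open>Absolute continuity speaks of families indexed by an initial segment of the
    naturals, so the finite set \<open>q\<close> is enumerated.\<close>
  then obtain h where h: "bij_betw h {..<card q} q"
    using ex_bij_betw_nat_finite[of q] by (auto simp: atLeast0LessThan)
  define u where "u i = Inf (snd (h i))" for i
  define v where "v i = Sup (snd (h i))" for i
  have hq: "h i \<in> p" "fst (h i) \<in> N" if "i < card q" for i
    using bij_betwE[OF h] that by (auto simp: q_def)
  have uv: "snd (h i) = {u i..v i}" "a \<le> u i" "u i \<le> v i" "v i \<le> b" "{u i<..<v i} \<subseteq> U"
    if i: "i < card q" for i
  proof -
    obtain y z where yz: "snd (h i) = {y..z}" "y \<le> fst (h i)" "fst (h i) \<le> z" "a \<le> y" "z \<le> b"
        "{y..z} \<subseteq> ball (fst (h i)) (r (fst (h i)))"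
      using elt[of "fst (h i)" "snd (h i)"] hq[OF i] by auto
    have "u i = y" "v i = z" using yz by (auto simp: u_def v_def)
    moreover have "{y<..<z} \<subseteq> U"
      using yz(6) r(2)[OF hq(2)[OF i]] greaterThanLessThan_subseteq_atLeastAtMost_iff[of y z y z]
      by blast
    ultimately show "snd (h i) = {u i..v i}" "a \<le> u i" "u i \<le> v i" "v i \<le> b" "{u i<..<v i} \<subseteq> U"
      using yz by auto
  qed
  have disj: "disjoint_family_on (\<lambda>i. {u i<..<v i}) {..<card q}"
    unfolding disjoint_family_on_def
  proof (intro ballI impI)
    fix i j assume ij: "i \<in> {..<card q}" "j \<in> {..<card q}" "i \<noteq> j"
    then have "h i \<noteq> h j" using h by (auto simp: bij_betw_def inj_on_def)
    \<comment> \<open>Members of a tagged division may share endpoints; only their interiors are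
      disjoint, which is what the open intervals in \<open>disj\<close> ask for.\<close>
    then have "interior (snd (h i)) \<inter> interior (snd (h j)) = {}"
      using tagged_division_ofD(5)[OF p(1), of "fst (h i)" "snd (h i)" "fst (h j)" "snd (h j)"]
        hq ij by auto
    then show "{u i<..<v i} \<inter> {u j<..<v j} = {}"
      using uv(1) ij by (simp add: interior_atLeastAtMost_real)
  qed
  have "(\<Sum>i<card q. v i - u i) < d"
    using sum_length_le_measure[OF disj] uv(3,5) U(1) \<open>emeasure lborel U < d\<close> by blast
  moreover have "(\<Sum>i<card q. \<bar>W (v i) - W (u i)\<bar>) < e"
    using d0[of "card q" u v] uv(2-4) disj calculation by (auto simp: d_def)
  moreover have sum_q: "(\<Sum>i<card q. F (v i) (u i)) = (\<Sum>(x, K)\<in>q. F (Sup K) (Inf K))"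
    for F :: "real \<Rightarrow> real \<Rightarrow> real"
    using sum.reindex_bij_betw[OF h, of "\<lambda>(x, K). F (Sup K) (Inf K)"]
    by (simp add: u_def v_def case_prod_unfold)
  ultimately have q: "(\<Sum>(x, K)\<in>q. Sup K - Inf K) < d"
      "(\<Sum>(x, K)\<in>q. \<bar>W (Sup K) - W (Inf K)\<bar>) < e"
    using sum_q[of "\<lambda>x y. x - y"] sum_q[of "\<lambda>x y. \<bar>W x - W y\<bar>"] by auto
  have "0 \<le> (\<Sum>(x, K)\<in>q. Sup K - Inf K)"
    using elt \<open>q \<subseteq> p\<close> by (fastforce intro!: sum_nonneg)
  with q(1) have "\<bar>\<Sum>(x, K)\<in>q. Sup K - Inf K\<bar> \<le> e" by (simp add: d_def)
  then have len: "\<bar>m - e\<bar> * \<bar>\<Sum>(x, K)\<in>q. Sup K - Inf K\<bar> \<le> \<bar>m - e\<bar> * e"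
    by (intro mult_left_mono) auto
  have split: "(\<Sum>z\<in>p. F z) = (\<Sum>z\<in>p - q. F z) + (\<Sum>z\<in>q. F z)" for F :: "real \<times> real set \<Rightarrow> real"
    using sum.subset_diff[OF \<open>q \<subseteq> p\<close> fin] .
  have "(\<Sum>(x, K)\<in>p - q. (m - e) * (Sup K - Inf K)) \<le> (\<Sum>(x, K)\<in>p - q. W (Sup K) - W (Inf K))"
  proof (rule sum_mono, clarify)
    fix x K assume xK: "(x, K) \<in> p" "(x, K) \<notin> q"
    obtain y z where yz: "K = {y..z}" "y \<le> x" "x \<le> z" "a \<le> y" "z \<le> b" "{y..z} \<subseteq> ball x (r x)"
      using elt[OF xK(1)] by blast
    have "y \<in> {y..z}" "z \<in> {y..z}" using yz by auto
    then have "y \<in> ball x (r x)" "z \<in> ball x (r x)" using yz(6) by blast+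
    moreover have "x \<in> {a..b} - N" using yz xK by (auto simp: q_def)
    ultimately have "(m - e) * (z - y) \<le> W z - W y" using r(3) yz by blast
    then show "(m - e) * (Sup K - Inf K) \<le> W (Sup K) - W (Inf K)" using yz by simp
  qed
  \<comment> \<open>The sum over the whole division telescopes to \<open>W b - W a\<close>; the same
    fact for the identity function then gives the length \<open>b - a\<close>.\<close>
  moreover have "(\<Sum>(x, K)\<in>p - q. W (Sup K) - W (Inf K)) =
      W b - W a - (\<Sum>(x, K)\<in>q. W (Sup K) - W (Inf K))"
    using additive_tagged_division_1[OF \<open>a \<le> b\<close> p(1), of W]
      split[of "\<lambda>(x, K). W (Sup K) - W (Inf K)"] by simp
  moreover have "(\<Sum>(x, K)\<in>p - q. Sup K - Inf K) = b - a - (\<Sum>(x, K)\<in>q. Sup K - Inf K)"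
    using additive_tagged_division_1[OF \<open>a \<le> b\<close> p(1), of "\<lambda>x. x"]
      split[of "\<lambda>(x, K). Sup K - Inf K"] by simp
  moreover have "(\<Sum>(x, K)\<in>p - q. (m - e) * (Sup K - Inf K)) =
      (m - e) * (\<Sum>(x, K)\<in>p - q. Sup K - Inf K)"
    by (simp add: sum_distrib_left case_prod_unfold)
  ultimately have 1: "(m - e) * (b - a - (\<Sum>(x, K)\<in>q. Sup K - Inf K))
      \<le> W b - W a - (\<Sum>(x, K)\<in>q. W (Sup K) - W (Inf K))"
    by metis
  have 2: "\<bar>\<Sum>(x, K)\<in>q. W (Sup K) - W (Inf K)\<bar> < e"
    using q(2) unfolding case_prod_unfold by (rule le_less_trans[OF sum_abs])
  have 3: "\<bar>(m - e) * (\<Sum>(x, K)\<in>q. Sup K - Inf K)\<bar> \<le> \<bar>m - e\<bar> * e"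
    using len by (simp add: abs_mult)
  have "(m - e) * (b - a) \<le> W b - W a - (\<Sum>(x, K)\<in>q. W (Sup K) - W (Inf K))
      + (m - e) * (\<Sum>(x, K)\<in>q. Sup K - Inf K)"
    using 1 unfolding right_diff_distrib[of "m - e" "b - a"] by (rule diff_le_eq[THEN iffD1])
  also have "\<dots> \<le> W b - W a + e + \<bar>m - e\<bar> * e"
    using abs_le_D2[OF less_imp_le[OF 2]] abs_le_D1[OF 3] by (intro add_mono) auto
  finally show ?thesis by (simp add: distrib_right)
qed

text \<open>The error in the approximate version vanishes as \<open>e\<close> tends to 0 from the
  right.\<close>

lemma locally_abs_cont_growth:
  fixes a b m :: real
  assumes "locally_abs_cont W" "N \<in> null_sets lborel"
    and "\<And>x. x \<in> {a..b} - N \<Longrightarrow> (W has_real_derivative D x) (at x)"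
    and "\<And>x. x \<in> {a..b} - N \<Longrightarrow> m \<le> D x"
    and "a \<le> b"
  shows "m * (b - a) \<le> W b - W a"
proof -
  have "((\<lambda>e. (m - e) * (b - a) - (\<bar>m - e\<bar> + 1) * e) \<longlongrightarrow> (m - 0) * (b - a) - (\<bar>m - 0\<bar> + 1) * 0)
      (at_right 0)"
    by (intro tendsto_intros)
  moreover have "\<forall>\<^sub>F e in at_right 0. (m - e) * (b - a) - (\<bar>m - e\<bar> + 1) * e \<le> W b - W a"
    using locally_abs_cont_growth_approx[OF assms(1-5)]
    by (auto simp: eventually_at_right_less intro: eventually_mono[OF eventually_at_right_less])
  ultimately show ?thesis
    using tendsto_upperbound[of _ _ "at_right (0::real)"] by fastforce
qed

section \<open>Support lines of the loss and the comparison of conditional risks\<close>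

text \<open>The line starts at \<open>y'\<close> but takes its slope at \<open>y0\<close>. Off
  \<open>N\<close>, every derivative met between \<open>y'\<close> and \<open>y\<close> is taken at
  a point on the far side of \<open>y'\<close> from \<open>y0\<close>, so monotonicity compares it
  with \<open>deriv W y0\<close>. Of the three points, only \<open>y0\<close> has to avoid
  \<open>N\<close>.\<close>

lemma support_line:
  fixes y0 y' y :: real
  assumes ac: "locally_abs_cont W" and N: "N \<in> null_sets lborel"
    and diff: "\<And>t. t \<notin> N \<Longrightarrow> W differentiable (at t)" and mono: "mono_on (- N) (deriv W)"
    and "y0 \<notin> N" and between: "y0 \<le> y' \<and> y' \<le> y \<or> y \<le> y' \<and> y' \<le> y0"
  shows "W y' + (y - y') * deriv W y0 \<le> W y"
proof -
  have D: "(W has_real_derivative deriv W t) (at t)" if "t \<notin> N" for t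
    using diff[OF that] by (simp add: DERIV_deriv_iff_real_differentiable)
  from between show ?thesis
  proof
    assume *: "y0 \<le> y' \<and> y' \<le> y"
    have "deriv W y0 * (y - y') \<le> W y - W y'"
      using * \<open>y0 \<notin> N\<close>
      by (intro locally_abs_cont_growth[OF ac N, where D = "deriv W"] D mono_onD[OF mono]) auto
    then show ?thesis by (simp add: algebra_simps)
  next
    assume *: "y \<le> y' \<and> y' \<le> y0"
    \<comment> \<open>To the left of \<open>y0\<close> the derivative is bounded above, so the
      growth bound is applied to \<open>- W\<close>.\<close>
    have "- deriv W y0 * (y' - y) \<le> - W y' - - W y"
      using * \<open>y0 \<notin> N\<close>
      by (intro locally_abs_cont_growth[OF locally_abs_cont_uminus[OF ac] N, where D = "\<lambda>t. - deriv W t"]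
            DERIV_minus D) (auto intro: mono_onD[OF mono])
    then show ?thesis by (simp add: algebra_simps)
  qed
qed

text \<open>Here \<open>k\<close> stands for an unnormalised conditional density and
  \<open>I\<close> for the equation defining \<open>c0\<close>. Integrating the support line
  inequality against \<open>k\<close> removes its linear term: the slope is always taken at
  \<open>s - c0\<close>, and the coefficient \<open>c' - c\<close> does not depend on
  \<open>s\<close>.\<close>

lemma weighted_loss_mono:
  fixes k :: "real \<Rightarrow> real" and c0 c' c :: real
  assumes ac: "locally_abs_cont W" and W: "\<And>t. 0 \<le> W t" and C2: "cond_C2 W"
    and k[measurable]: "k \<in> borel_measurable borel" and k0: "\<And>s. 0 \<le> k s"
    and I: "has_bochner_integral lborel (\<lambda>s. deriv W (s - c0) * k s) 0"
    and between: "c \<le> c' \<and> c' \<le> c0 \<or> c0 \<le> c' \<and> c' \<le> c"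
  shows "(\<integral>\<^sup>+s. ennreal (W (s - c') * k s) \<partial>lborel) \<le> (\<integral>\<^sup>+s. ennreal (W (s - c) * k s) \<partial>lborel)"
    (is "?L \<le> ?R")
proof (cases "?R = \<infinity>")
  case False
  have [measurable]: "W \<in> borel_measurable borel"
    using locally_abs_cont_imp_continuous[OF ac] by (rule borel_measurable_continuous_onI)
  obtain N where N: "N \<in> null_sets lborel" "\<And>t. t \<notin> N \<Longrightarrow> W differentiable (at t)"
      "mono_on (- N) (deriv W)"
    using C2 unfolding cond_C2_def by blast
  have [measurable]: "N \<in> sets borel" using N(1) by auto
  have "AE s in lborel. s \<notin> N" using N(1) by (rule AE_not_in)
  \<comment> \<open>A translate of a null set is null; the shape \<open>- c0 + 1 * s\<close> is that
    of an affine change of variables.\<close>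
  then have "AE s in lborel. - c0 + 1 * s \<notin> N" by (intro AE_borel_affine) auto
  then have ineq: "AE s in lborel. W (s - c') * k s \<le> W (s - c) * k s - (c' - c) * (deriv W (s - c0) * k s)"
  proof eventually_elim
    case (elim s)
    have "W (s - c') + ((s - c) - (s - c')) * deriv W (s - c0) \<le> W (s - c)"
      using between elim by (intro support_line[OF ac N]) auto
    then have "(W (s - c') + (c' - c) * deriv W (s - c0)) * k s \<le> W (s - c) * k s"
      using k0 by (intro mult_right_mono) auto
    then show ?case by (simp add: algebra_simps)
  qed
  \<comment> \<open>In the remaining case the right-hand side is finite, which gives integrability
    and lets the difference be split under the Bochner integral.\<close>
  have int: "integrable lborel (\<lambda>s. W (s - c) * k s)"
    using False W k0 by (intro integrableI_nonneg) (auto simp: top.not_eq_extremum)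
  have int': "integrable lborel (\<lambda>s. (c' - c) * (deriv W (s - c0) * k s))"
    using I by (intro integrable_mult_right) (simp add: has_bochner_integral_iff)
  have "?L \<le> (\<integral>\<^sup>+s. ennreal (W (s - c) * k s - (c' - c) * (deriv W (s - c0) * k s)) \<partial>lborel)"
    using ineq by (intro nn_integral_mono_AE) (auto intro: ennreal_leI)
  \<comment> \<open>The integrand is a difference, but it is nonnegative almost everywhere because
    it dominates \<open>W (s - c') * k s\<close>.\<close>
  also have "\<dots> = ennreal (LINT s|lborel. W (s - c) * k s - (c' - c) * (deriv W (s - c0) * k s))"
    using int int' ineq W k0
    by (intro nn_integral_eq_integral) (auto elim!: eventually_mono intro: order_trans[OF mult_nonneg_nonneg[OF W k0]] simp del: diff_ge_0_iff_ge)
  also have "\<dots> = ennreal (LINT s|lborel. W (s - c) * k s)"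
    using int int' I by (simp add: has_bochner_integral_iff)
  also have "\<dots> = ?R"
    using int W k0 by (intro nn_integral_eq_integral[symmetric]) auto
  finally show ?thesis .
qed simp

section \<open>Lower integrals, and the law in location-invariant coordinates\<close>

lemma nn_integral_leI_minorants:
  assumes "\<And>g. g \<in> borel_measurable M \<Longrightarrow> g \<le> u \<Longrightarrow> integral\<^sup>N M g \<le> B"
  shows "integral\<^sup>N M u \<le> B"
  unfolding nn_integral_def
  using assms by (auto intro!: SUP_least simp: nn_integral_eq_simple_integral[symmetric]
      dest: borel_measurable_simple_function)

text \<open>The coordinates are \<open>s = x1 - fst \<theta>\<close> and \<open>t = x2 - x1\<close>.
  Each variable is translated separately, with Tonelli's theorem in between, so no Jacobian factor
  appears. The shift \<open>snd \<theta> - fst \<theta>\<close> is \<lambda>.\<close>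

lemma nn_integral_law:
  fixes f :: "real \<times> real \<Rightarrow> real"
  assumes f[measurable]: "f \<in> borel_measurable borel"
    and g[measurable]: "g \<in> borel_measurable borel"
  shows "(\<integral>\<^sup>+x. g x \<partial>law f \<theta>) =
    (\<integral>\<^sup>+t. \<integral>\<^sup>+s. ennreal (f (s, s + (t - (snd \<theta> - fst \<theta>)))) * g (s + fst \<theta>, s + fst \<theta> + t)
       \<partial>lborel \<partial>lborel)"
proof -
  note [measurable] = f[unfolded borel_prod[symmetric]] g[unfolded borel_prod[symmetric]]
  define G where "G x = ennreal (f (fst x - fst \<theta>, snd x - snd \<theta>)) * g x" for x
  have G[measurable]: "G \<in> borel_measurable (lborel \<Otimes>\<^sub>M lborel)"
    unfolding G_def by measurable
  have G'[measurable]: "G \<in> borel_measurable (borel \<Otimes>\<^sub>M borel)"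
    unfolding G_def by measurable
  have "(\<integral>\<^sup>+x. g x \<partial>law f \<theta>) = integral\<^sup>N lborel G"
    unfolding law_def G_def case_prod_unfold
    by (subst nn_integral_density) (auto simp: borel_prod[symmetric])
  also have "\<dots> = (\<integral>\<^sup>+x1. \<integral>\<^sup>+x2. G (x1, x2) \<partial>lborel \<partial>lborel)"
    using lborel.nn_integral_fst[OF G] by (simp add: lborel_prod)
  also have "\<dots> = (\<integral>\<^sup>+x1. \<integral>\<^sup>+t. G (x1, x1 + 1 * t) \<partial>lborel \<partial>lborel)"
  proof (rule nn_integral_cong)
    fix x1 :: real
    show "(\<integral>\<^sup>+x2. G (x1, x2) \<partial>lborel) = (\<integral>\<^sup>+t. G (x1, x1 + 1 * t) \<partial>lborel)"
      by (subst nn_integral_real_affine[where c = 1 and t = x1]) auto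
  qed
  also have "\<dots> = (\<integral>\<^sup>+t. \<integral>\<^sup>+x1. G (x1, x1 + 1 * t) \<partial>lborel \<partial>lborel)"
    by (rule lborel_pair.Fubini'[symmetric]) measurable
  also have "\<dots> = (\<integral>\<^sup>+t. \<integral>\<^sup>+s. G (fst \<theta> + 1 * s, fst \<theta> + 1 * s + 1 * t) \<partial>lborel \<partial>lborel)"
  proof (rule nn_integral_cong)
    fix t :: real
    show "(\<integral>\<^sup>+x1. G (x1, x1 + 1 * t) \<partial>lborel) =
        (\<integral>\<^sup>+s. G (fst \<theta> + 1 * s, fst \<theta> + 1 * s + 1 * t) \<partial>lborel)"
      by (subst nn_integral_real_affine[where c = 1 and t = "fst \<theta>"]) auto
  qed
  finally show ?thesis
    by (simp add: G_def algebra_simps)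
qed

theorem theorem2p1p1:
  fixes f :: "real \<times> real \<Rightarrow> real"
    and W :: "real \<Rightarrow> real"
    and psi_lam :: "real \<Rightarrow> real \<Rightarrow> real"
    and \<psi> psi_lo psi_hi :: "real \<Rightarrow> real"
  assumes "prob_density f"
    and "\<And>t. 0 \<le> W t"
    and "locally_abs_cont W"
    and "cond_C1 W"
    and "cond_C2 W"
    and "cond_A1 f W psi_lam"
    and "\<psi> \<in> borel_measurable borel"
    and "\<And>lam t. 0 \<le> lam \<Longrightarrow> psi_lo t < psi_lam lam t \<and> psi_lam lam t < psi_hi t"
  shows "\<forall>\<theta> \<in> Theta0.
           risk1 f W \<theta> (equivariant_est \<psi>)
             \<ge> risk1 f W \<theta> (equivariant_est (psi_star psi_lo psi_hi \<psi>))"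
proof
  fix \<theta> assume "\<theta> \<in> Theta0"
  define lam where "lam = snd \<theta> - fst \<theta>"
  have lam: "0 \<le> lam" using \<open>\<theta> \<in> Theta0\<close> by (simp add: lam_def Theta0_def)
  let ?\<psi>' = "psi_star psi_lo psi_hi \<psi>"
  have f[measurable]: "f \<in> borel_measurable borel" and f0: "\<And>x. 0 \<le> f x"
    using assms(1) by (auto simp: prob_density_def)
  note [measurable] = assms(7) f[unfolded borel_prod[symmetric]]
  have [measurable]: "W \<in> borel_measurable borel"
    using locally_abs_cont_imp_continuous[OF assms(3)] by (rule borel_measurable_continuous_onI)
  have cond: "(\<integral>\<^sup>+s. ennreal (W (s - ?\<psi>' t) * f (s, s + (t - lam))) \<partial>lborel)
      \<le> (\<integral>\<^sup>+s. ennreal (W (s - \<psi> t) * f (s, s + (t - lam))) \<partial>lborel)" for t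
  proof (rule weighted_loss_mono[OF assms(3,2,5)])
    define M where "M = (LINT u|lborel. f (u, u + (t - lam)))"
    have A1: "has_bochner_integral lborel (\<lambda>s. deriv W (s - psi_lam lam t) * cond_density f s (t - lam)) 0"
        "0 < cond_density f (psi_lam lam t) (t - lam)"
      using assms(6) lam unfolding cond_A1_def by blast+
    \<comment> \<open>If \<open>M\<close> were 0, division by zero would return 0 and the
      conditional density could not be positive. This also rules out a non-integrable slice, whose
      integral is 0 by default. Multiplying by \<open>M\<close> then turns the equation in
      \<open>cond_A1\<close> into one for the joint density.\<close>
    have "M \<noteq> 0" using A1(2) by (auto simp: cond_density_def M_def)
    then show "has_bochner_integral lborel (\<lambda>s. deriv W (s - psi_lam lam t) * f (s, s + (t - lam))) 0"
      using has_bochner_integral_mult_right[OF A1(1), of M]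
      by (simp add: cond_density_def M_def[symmetric])
    \<comment> \<open>Clipping to an interval that contains \<open>psi_lam lam t\<close> moves
      \<open>\<psi> t\<close> only towards that point and never past it.\<close>
    show "\<psi> t \<le> ?\<psi>' t \<and> ?\<psi>' t \<le> psi_lam lam t \<or>
        psi_lam lam t \<le> ?\<psi>' t \<and> ?\<psi>' t \<le> \<psi> t"
      using assms(8)[OF lam, of t] by (auto simp: psi_star_def)
  qed (use f0 in \<open>auto\<close>)
  show "risk1 f W \<theta> (equivariant_est ?\<psi>') \<le> risk1 f W \<theta> (equivariant_est \<psi>)"
    unfolding risk1_def
  proof (rule nn_integral_leI_minorants)
    fix g assume "g \<in> borel_measurable (law f \<theta>)"
      and le: "g \<le> (\<lambda>x. ennreal (W (equivariant_est ?\<psi>' x - fst \<theta>)))"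
    then have g: "g \<in> borel_measurable borel" by (simp add: law_def)
    have "(\<integral>\<^sup>+x. g x \<partial>law f \<theta>) = (\<integral>\<^sup>+t. \<integral>\<^sup>+s. ennreal (f (s, s + (t - lam))) *
        g (s + fst \<theta>, s + fst \<theta> + t) \<partial>lborel \<partial>lborel)"
      by (simp only: nn_integral_law[OF f g] lam_def)
    \<comment> \<open>From here on only monotonicity of the integral is used, which holds without
      measurability in \<open>t\<close>; for fixed \<open>t\<close> the clipped value is a
      constant.\<close>
    also have "\<dots> \<le> (\<integral>\<^sup>+t. \<integral>\<^sup>+s. ennreal (W (s - ?\<psi>' t) * f (s, s + (t - lam))) \<partial>lborel \<partial>lborel)"
    proof (intro nn_integral_mono)
      fix t s :: real
      show "ennreal (f (s, s + (t - lam))) * g (s + fst \<theta>, s + fst \<theta> + t)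
          \<le> ennreal (W (s - ?\<psi>' t) * f (s, s + (t - lam)))"
        using le_funD[OF le, of "(s + fst \<theta>, s + fst \<theta> + t)"] assms(2) f0
        by (simp add: equivariant_est_def ennreal_mult mult.commute[of "ennreal (W _)"] add.assoc
            mult_left_mono)
    qed
    also have "\<dots> \<le> (\<integral>\<^sup>+t. \<integral>\<^sup>+s. ennreal (W (s - \<psi> t) * f (s, s + (t - lam))) \<partial>lborel \<partial>lborel)"
      by (intro nn_integral_mono cond)
    \<comment> \<open>Since \<psi> itself is measurable, the change of variables can be reversed as
      an equality.\<close>
    also have "\<dots> = (\<integral>\<^sup>+x. ennreal (W (equivariant_est \<psi> x - fst \<theta>)) \<partial>law f \<theta>)"
    proof (subst nn_integral_law[OF f])
      show "(\<lambda>x. ennreal (W (equivariant_est \<psi> x - fst \<theta>))) \<in> borel_measurable borel"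
        unfolding equivariant_est_def case_prod_unfold borel_prod[symmetric] by measurable
    qed (use assms(2) f0 in \<open>simp add: equivariant_est_def ennreal_mult lam_def algebra_simps\<close>)
    finally show "(\<integral>\<^sup>+x. g x \<partial>law f \<theta>) \<le> (\<integral>\<^sup>+x. ennreal (W (equivariant_est \<psi> x - fst \<theta>)) \<partial>law f \<theta>)" .
  qed
qed

end
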